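(* Let $a,b$ be positive real numbers, let $\nu\in[0,1]$, let $n\ge 1$ be an integer, and put $h=\frac{b}{a}$. Then $$K(h^{\frac{1}{2^n}},2)^{r_n}\,a^{1-\nu}b^{\nu}\;\le\;(1-\nu)a+\nu b-\sum_{k=0}^{n-1}r_k\Big[\big(a^{1-\frac{m_k}{2^k}}b^{\frac{m_k}{2^k}}\big)^{\frac12}-\big(a^{1-\frac{m_k+1}{2^k}}b^{\frac{m_k+1}{2^k}}\big)^{\frac12}\Big]^2\;\le\;K(h^{\frac{1}{2^n}},2)^{R_n}\,a^{1-\nu}b^{\nu}.$$ In addition, if $\nu=\frac{p}{2^t}$ for some $p,t\in\mathbb{N}$ with $t>1$, then $$K(h^{\frac{1}{2^{t-1}}},2)^{r_{t-1}}\,a^{1-\nu}b^{\nu}=(1-\nu)a+\nu b-\sum_{k=0}^{t-2}r_k\Big[\big(a^{1-\frac{m_k}{2^k}}b^{\frac{m_k}{2^k}}\big)^{\frac12}-\big(a^{1-\frac{m_k+1}{2^k}}b^{\frac{m_k+1}{2^k}}\big)^{\frac12}\Big]^2=K(h^{\frac{1}{2^{t-1}}},2)^{R_{t-1}}\,a^{1-\nu}b^{\nu}.$$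
   Context: For $t>0$, $K(t,2)=\frac{(1+t)^2}{4t}$ (Kantorovich constant). For $\nu\in[0,1]$ and integers $k\ge 0$: $m_k=\lfloor 2^k\nu\rfloor$; $r_0=\min\{\nu,1-\nu\}$ and $r_k=\min\{2r_{k-1},1-2r_{k-1}\}$ for $k\ge 1$; $R_k=1-r_k$. Powers of positive reals are real powers.
   Formalization: The last equality (with exponent R_{t-1}) is stated only for odd p, since for even p it fails when a ≠ b (e.g. ν=2/4, a=1, b=9 gives 3 versus 4); the first equality is stated for all p. *)

theory Defs
  imports Complex_Main
begin

text \<open>The Kantorovich constant \<open>K(t,2)\<close>, used only for \<open>t > 0\<close>.\<close>

definition kantorovich2 :: "real \<Rightarrow> real" where
  "kantorovich2 t = (1 + t)^2 / (4 * t)"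

definition m_seq :: "real \<Rightarrow> nat \<Rightarrow> int" where
  "m_seq \<nu> k = \<lfloor>2 ^ k * \<nu>\<rfloor>"

primrec r_seq :: "real \<Rightarrow> nat \<Rightarrow> real" where
  "r_seq \<nu> 0 = min \<nu> (1 - \<nu>)"
| "r_seq \<nu> (Suc k) = min (2 * r_seq \<nu> k) (1 - 2 * r_seq \<nu> k)"

definition R_seq :: "real \<Rightarrow> nat \<Rightarrow> real" where
  "R_seq \<nu> k = 1 - r_seq \<nu> k"

text \<open>The sum subtracted from the arithmetic mean, with \<open>N\<close> terms \<open>k = 0, \<dots>, N - 1\<close>.\<close>

definition young_sum :: "real \<Rightarrow> real \<Rightarrow> real \<Rightarrow> nat \<Rightarrow> real" where
  "young_sum a b \<nu> N =
    (\<Sum>k<N. r_seq \<nu> k *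
      ((a powr (1 - of_int (m_seq \<nu> k) / 2 ^ k) * b powr (of_int (m_seq \<nu> k) / 2 ^ k)) powr (1/2)
       - (a powr (1 - (of_int (m_seq \<nu> k) + 1) / 2 ^ k)
          * b powr ((of_int (m_seq \<nu> k) + 1) / 2 ^ k)) powr (1/2))^2)"

end

(* Put f_k = frac (2^k \<nu>) and let x_k, y_k be the weighted geometric means of a and b at the
   dyadic parameters m_k / 2^k and (m_k + 1) / 2^k. Then r_k is the distance of f_k to {0, 1}, and
   subtracting r_k (sqrt x_k - sqrt y_k)^2 from (1 - f_k) x_k + f_k y_k replaces one endpoint by
   sqrt (x_k y_k), giving (1 - f_{k+1}) x_{k+1} + f_{k+1} y_{k+1}. Hence the middle term of the
   theorem telescopes to (1 - f_n) x_n + f_n y_n. Since y_n / x_n = h^(1/2^n), only the inequality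
   K(y/x)^r x^(1-f) y^f <= (1 - f) x + f y <= K(y/x)^(1-r) x^(1-f) y^f, r = min f (1 - f),
   is needed. Both halves are instances of weighted AM-GM involving the mean (x + y) / 2; at f = 1/2
   they are equalities. *)
theory Submission
  imports Defs "HOL-Analysis.Convex"
begin

definition wgm :: "real \<Rightarrow> real \<Rightarrow> real \<Rightarrow> real" where
  "wgm a b u = a powr (1 - u) * b powr u"

lemma wgm_pos: "a > 0 \<Longrightarrow> b > 0 \<Longrightarrow> wgm a b u > 0"
  by (simp add: wgm_def)

text \<open>The logarithm of \<open>wgm a b u\<close> is affine in u, so taking a weighted mean of
  two of its values averages the two parameters.\<close>

lemma wgm_wgm:
  assumes "a > 0" "b > 0"
  shows "wgm (wgm a b u) (wgm a b v) s = wgm a b ((1 - s) * u + s * v)"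
proof -
  have "ln (wgm a b w) = (1 - w) * ln a + w * ln b" for w
    using assms by (simp add: wgm_def ln_mult ln_powr)
  moreover have "wgm c d w = exp ((1 - w) * ln c + w * ln d)" if "c > 0" "d > 0" for c d w
    using that by (simp add: wgm_def powr_def exp_add)
  ultimately show ?thesis
    using assms by (simp add: wgm_pos algebra_simps)
qed

lemma wgm_divide:
  assumes "a > 0" "b > 0"
  shows "wgm a b v / wgm a b u = (b / a) powr (v - u)"
  using assms
  by (simp add: wgm_def powr_def ln_div algebra_simps flip: exp_add exp_diff)

lemma wgm_half: "x > 0 \<Longrightarrow> y > 0 \<Longrightarrow> wgm x y (1/2) = sqrt x * sqrt y"
  by (simp add: wgm_def powr_half_sqrt)

lemma wgm_le_arith_mean:
  assumes "x > 0" "y > 0" "0 \<le> f" "f \<le> 1"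
  shows "wgm x y f \<le> (1 - f) * x + f * y"
  using Youngs_inequality_0[of "1 - f" f x y] assms by (simp add: wgm_def)

lemma kantorovich2_pos: "t > 0 \<Longrightarrow> kantorovich2 t > 0"
  by (simp add: kantorovich2_def)

lemma kantorovich2_divide_commute:
  "x > 0 \<Longrightarrow> y > 0 \<Longrightarrow> kantorovich2 (x / y) = kantorovich2 (y / x)"
  by (simp add: kantorovich2_def field_simps power2_eq_square)

text \<open>With M = (x + y) / 2 the constant equals M^2 / (x y), so the product is a monomial in M,
  x and y. Taking s = f removes y, s = 1 - f removes x, and s = f = 1/2 removes both.\<close>

lemma kantorovich2_powr_mult_wgm:
  assumes "x > 0" "y > 0"
  shows "kantorovich2 (y / x) powr s * wgm x y f
       = ((x + y) / 2) powr (2 * s) * (x powr (1 - f - s) * y powr (f - s))"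
proof -
  define M where "M = (x + y) / 2"
  have "M > 0" using assms by (simp add: M_def)
  have "kantorovich2 (y / x) = M ^ 2 / (x * y)"
    using assms by (simp add: kantorovich2_def M_def field_simps power2_eq_square)
  then have K: "ln (kantorovich2 (y / x)) = 2 * ln M - ln x - ln y"
    using assms \<open>M > 0\<close> by (simp add: ln_div ln_mult ln_realpow)
  have "kantorovich2 (y / x) > 0"
    using assms by (simp add: kantorovich2_pos)
  then have "kantorovich2 (y / x) powr s * wgm x y f
      = exp (s * ln (kantorovich2 (y / x)) + ((1 - f) * ln x + f * ln y))"
    using assms by (simp add: wgm_def powr_def exp_add)
  also have "\<dots> = exp (2 * s * ln M + ((1 - f - s) * ln x + (f - s) * ln y))"
    unfolding K by (simp add: algebra_simps)
  also have "\<dots> = M powr (2 * s) * (x powr (1 - f - s) * y powr (f - s))"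
    using assms \<open>M > 0\<close> by (simp add: powr_def exp_add)
  finally show ?thesis
    unfolding M_def .
qed

text \<open>Exponent f removes y, leaving weighted AM-GM for x and (x + y) / 2 with weight 2 f on
  the latter.\<close>

lemma kantorovich2_young_lower:
  assumes "x > 0" "y > 0" "0 \<le> f" "f \<le> 1/2"
  shows "kantorovich2 (y / x) powr f * wgm x y f \<le> (1 - f) * x + f * y"
proof -
  have "kantorovich2 (y / x) powr f * wgm x y f = wgm x ((x + y) / 2) (2 * f)"
    using assms unfolding kantorovich2_powr_mult_wgm[OF assms(1,2)]
    by (simp add: wgm_def mult.commute)
  also have "\<dots> \<le> (1 - 2 * f) * x + 2 * f * ((x + y) / 2)"
    using assms by (intro wgm_le_arith_mean) auto
  also have "\<dots> = (1 - f) * x + f * y"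
    by (simp add: field_simps)
  finally show ?thesis .
qed

text \<open>Exponent 1 - f removes x. With A the left-hand side, what remains is A y^(1 - 2 f) \<le>
  ((x + y) / 2)^(2 - 2 f), which is weighted AM-GM for A and y raised to the power 2 - 2 f.\<close>

lemma kantorovich2_young_upper:
  assumes "x > 0" "y > 0" "0 \<le> f" "f \<le> 1/2"
  shows "(1 - f) * x + f * y \<le> kantorovich2 (y / x) powr (1 - f) * wgm x y f"
proof -
  define A where "A = (1 - f) * x + f * y"
  \<comment> \<open>The exponents 1 of A and 1 - 2 f of y, divided by their sum, give the weights 1
    - w and w.\<close>
  define w where "w = (1 - 2 * f) / (2 - 2 * f)"
  have f: "2 - 2 * f > 0" using assms by simp
  have A: "A > 0" unfolding A_def using assms by (intro add_pos_nonneg) auto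
  have w: "0 \<le> w" "w \<le> 1" "(2 - 2 * f) * w = 1 - 2 * f" "(2 - 2 * f) * (1 - w) = 1"
    using assms f by (auto simp: w_def field_simps)
  \<comment> \<open>The arithmetic mean of \<open>A\<close> and \<open>y\<close> with weight \<open>w\<close> on \<open>y\<close> is exactly \<open>(x + y) / 2\<close>.\<close>
  have "(2 - 2 * f) * ((1 - w) * A + w * y) = ((2 - 2 * f) * (1 - w)) * A + ((2 - 2 * f) * w) * y"
    by (simp only: algebra_simps)
  also have "\<dots> = (2 - 2 * f) * ((x + y) / 2)"
    unfolding w A_def by (simp add: field_simps)
  finally have "(1 - w) * A + w * y = (x + y) / 2"
    using f by simp
  then have "wgm A y w \<le> (x + y) / 2"
    using wgm_le_arith_mean[of A y w] A w assms by simp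
  then have "wgm A y w powr (2 - 2 * f) \<le> ((x + y) / 2) powr (2 - 2 * f)"
    using A assms by (intro powr_mono2) (auto simp: wgm_pos less_imp_le)
  moreover have "wgm A y w powr (2 - 2 * f) = A * y powr (1 - 2 * f)"
    using A assms w by (simp add: wgm_def powr_mult powr_powr mult.commute)
  ultimately have "A * y powr (1 - 2 * f) \<le> ((x + y) / 2) powr (2 - 2 * f)"
    by simp
  then have "A * y powr (1 - 2 * f) * y powr (2 * f - 1)
      \<le> ((x + y) / 2) powr (2 - 2 * f) * y powr (2 * f - 1)"
    by (rule mult_right_mono) simp
  moreover have "y powr (1 - 2 * f) * y powr (2 * f - 1) = 1"
    using assms by (simp flip: powr_add)
  ultimately have "A \<le> ((x + y) / 2) powr (2 - 2 * f) * y powr (2 * f - 1)"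
    by (simp add: mult.assoc)
  then show ?thesis
    using assms unfolding kantorovich2_powr_mult_wgm[OF assms(1,2)] A_def
    by (simp add: algebra_simps)
qed

text \<open>Exchanging x with y and f with 1 - f changes neither the means nor the constant, which
  reduces f > 1/2 to f < 1/2.\<close>

lemma kantorovich2_young:
  assumes "x > 0" "y > 0" "0 \<le> f" "f \<le> 1" and r: "r = min f (1 - f)"
  shows "kantorovich2 (y / x) powr r * wgm x y f \<le> (1 - f) * x + f * y"
    and "(1 - f) * x + f * y \<le> kantorovich2 (y / x) powr (1 - r) * wgm x y f"
proof -
  have swap: "kantorovich2 (x / y) = kantorovich2 (y / x)" "wgm y x (1 - f) = wgm x y f"
    using assms by (simp_all add: kantorovich2_divide_commute wgm_def mult.commute)
  show "kantorovich2 (y / x) powr r * wgm x y f \<le> (1 - f) * x + f * y"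
    using kantorovich2_young_lower[of x y f] kantorovich2_young_lower[of y x "1 - f"] assms
    by (cases "f \<le> 1/2") (auto simp: swap min_def)
  show "(1 - f) * x + f * y \<le> kantorovich2 (y / x) powr (1 - r) * wgm x y f"
    using kantorovich2_young_upper[of x y f] kantorovich2_young_upper[of y x "1 - f"] assms
    by (cases "f \<le> 1/2") (auto simp: swap min_def)
qed

lemma floor_double:
  fixes x :: real
  shows "\<lfloor>2 * x\<rfloor> = (if frac x < 1/2 then 2 * \<lfloor>x\<rfloor> else 2 * \<lfloor>x\<rfloor> + 1)"
  unfolding frac_def by (simp add: floor_eq_iff) linarith

lemma frac_double:
  fixes x :: real
  shows "frac (2 * x) = (if frac x < 1/2 then 2 * frac x else 2 * frac x - 1)"
  using floor_double[of x] by (auto simp: frac_def)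

text \<open>The recursion of \<open>r_seq\<close> is how the distance to the nearest integer changes
  when its argument is doubled.\<close>

lemma r_seq_eq_frac:
  assumes "0 \<le> \<nu>" "\<nu> \<le> 1"
  shows "r_seq \<nu> k = min (frac (2 ^ k * \<nu>)) (1 - frac (2 ^ k * \<nu>))"
proof (induction k)
  case 0
  show ?case
  proof (cases "\<nu> = 1")
    case False
    then have "frac \<nu> = \<nu>" using assms by (simp add: frac_eq)
    then show ?thesis by simp
  qed simp
next
  case (Suc k)
  have "frac (2 ^ Suc k * \<nu>) = frac (2 * (2 ^ k * \<nu>))" by (simp add: mult.assoc)
  then show ?case
    using Suc by (auto simp: frac_double min_def)
qed

text \<open>Each induction step bisects the dyadic interval around \<nu> and keeps the half that
  contains \<nu>.\<close>

lemma arith_mean_minus_young_sum: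
  fixes a b \<nu> :: real
  assumes "a > 0" "b > 0" "0 \<le> \<nu>" "\<nu> \<le> 1"
  shows "(1 - \<nu>) * a + \<nu> * b - young_sum a b \<nu> n
    = (1 - frac (2 ^ n * \<nu>)) * wgm a b (m_seq \<nu> n / 2 ^ n)
      + frac (2 ^ n * \<nu>) * wgm a b ((m_seq \<nu> n + 1) / 2 ^ n)"
proof (induction n)
  case 0
  show ?case
  \<comment> \<open>At \<nu> = 1 the floor jumps to 1 and the fractional part to 0, so b appears as
    the left endpoint instead of the right one.\<close>
  proof (cases "\<nu> = 1")
    case False
    then have "frac \<nu> = \<nu>" "\<lfloor>\<nu>\<rfloor> = 0" using assms by (simp_all add: frac_eq floor_eq_iff)
    then show ?thesis using assms by (simp add: young_sum_def m_seq_def wgm_def)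
  qed (use assms in \<open>simp add: young_sum_def m_seq_def wgm_def\<close>)
next
  case (Suc n)
  define f m where "f = frac (2 ^ n * \<nu>)" and "m = m_seq \<nu> n"
  define x y where "x = wgm a b (m / 2 ^ n)" and "y = wgm a b ((m + 1) / 2 ^ n)"
  have pos: "x > 0" "y > 0" using assms by (simp_all add: x_def y_def wgm_pos)
  have mid: "sqrt x * sqrt y = wgm a b ((2 * m + 1) / 2 ^ Suc n)"
  proof -
    have "sqrt x * sqrt y = wgm x y (1/2)" using pos by (simp add: wgm_half)
    also have "\<dots> = wgm a b ((1 - 1/2) * (m / 2 ^ n) + 1/2 * ((m + 1) / 2 ^ n))"
      unfolding x_def y_def of_int_add of_int_1 by (rule wgm_wgm[OF assms(1,2)])
    also have "(1 - 1/2) * (m / 2 ^ n) + 1/2 * ((m + 1) / 2 ^ n) = (2 * m + 1) / (2 ^ Suc n :: real)"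
      by (simp add: field_simps)
    finally show ?thesis .
  qed
  \<comment> \<open>The old endpoints are rewritten over the new denominator, to match numerators 2
    m and 2 m + 1 for the two halves.\<close>
  have ends: "x = wgm a b (2 * m / 2 ^ Suc n)" "y = wgm a b ((2 * m + 2) / 2 ^ Suc n)"
    unfolding x_def y_def by (rule arg_cong[of _ _ "wgm a b"], simp add: field_simps)+
  have "young_sum a b \<nu> (Suc n) = young_sum a b \<nu> n + r_seq \<nu> n * (sqrt x - sqrt y)\<^sup>2"
    using pos by (simp add: young_sum_def x_def y_def m_def wgm_def powr_half_sqrt)
  also have "(sqrt x - sqrt y)\<^sup>2 = x + y - 2 * (sqrt x * sqrt y)"
    using pos by (simp add: power2_diff)
  finally have "(1 - \<nu>) * a + \<nu> * b - young_sum a b \<nu> (Suc n)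
      = (1 - f) * x + f * y - min f (1 - f) * (x + y - 2 * (sqrt x * sqrt y))"
    using Suc assms by (simp add: r_seq_eq_frac f_def m_def x_def y_def algebra_simps)
  \<comment> \<open>Subtracting \<open>min f (1 - f)\<close> cancels the coefficient of one
    endpoint: y if f < 1/2, and x otherwise.\<close>
  also have "\<dots> = (if f < 1/2 then (1 - 2 * f) * x + 2 * f * (sqrt x * sqrt y)
      else (2 - 2 * f) * (sqrt x * sqrt y) + (2 * f - 1) * y)"
  proof -
    have "min f (1 - f) = (if f < 1/2 then f else 1 - f)" by auto
    then show ?thesis by (simp add: algebra_simps)
  qed
  also have "\<dots> = (1 - frac (2 ^ Suc n * \<nu>)) * wgm a b (m_seq \<nu> (Suc n) / 2 ^ Suc n)
      + frac (2 ^ Suc n * \<nu>) * wgm a b ((m_seq \<nu> (Suc n) + 1) / 2 ^ Suc n)"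
  proof -
    have "2 ^ Suc n * \<nu> = 2 * (2 ^ n * \<nu>)" by simp
    then have "frac (2 ^ Suc n * \<nu>) = (if f < 1/2 then 2 * f else 2 * f - 1)"
      "m_seq \<nu> (Suc n) = (if f < 1/2 then 2 * m else 2 * m + 1)"
      unfolding m_seq_def m_def f_def by (simp_all only: frac_double floor_double)
    then show ?thesis
      unfolding mid unfolding ends by (simp add: add.assoc)
  qed
  finally show ?case .
qed

theorem theorem2p1:
  fixes a b \<nu> h :: real and n :: nat
  assumes "a > 0" and "b > 0" and "0 \<le> \<nu>" and "\<nu> \<le> 1" and "n \<ge> 1" and "h = b / a"
  shows "kantorovich2 (h powr (1 / 2 ^ n)) powr r_seq \<nu> n * (a powr (1 - \<nu>) * b powr \<nu>)
           \<le> (1 - \<nu>) * a + \<nu> * b - young_sum a b \<nu> n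
       \<and> (1 - \<nu>) * a + \<nu> * b - young_sum a b \<nu> n
           \<le> kantorovich2 (h powr (1 / 2 ^ n)) powr R_seq \<nu> n * (a powr (1 - \<nu>) * b powr \<nu>)
       \<and> (\<forall>p t :: nat. t > 1 \<and> \<nu> = real p / 2 ^ t \<longrightarrow>
           kantorovich2 (h powr (1 / 2 ^ (t - 1))) powr r_seq \<nu> (t - 1) * (a powr (1 - \<nu>) * b powr \<nu>)
             = (1 - \<nu>) * a + \<nu> * b - young_sum a b \<nu> (t - 1)
           \<and> (odd p \<longrightarrow>
               (1 - \<nu>) * a + \<nu> * b - young_sum a b \<nu> (t - 1)
                 = kantorovich2 (h powr (1 / 2 ^ (t - 1))) powr R_seq \<nu> (t - 1)
                     * (a powr (1 - \<nu>) * b powr \<nu>)))"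
proof -
  define x y f where "x = (\<lambda>k. wgm a b (m_seq \<nu> k / 2 ^ k))"
    and "y = (\<lambda>k. wgm a b ((m_seq \<nu> k + 1) / 2 ^ k))" and "f = (\<lambda>k. frac (2 ^ k * \<nu>))"
  have pos: "x k > 0" "y k > 0" for k
    using assms by (simp_all add: x_def y_def wgm_pos)
  have ratio: "y k / x k = h powr (1 / 2 ^ k)" for k
    using assms by (simp add: x_def y_def wgm_divide flip: diff_divide_distrib)
  \<comment> \<open>\<nu> sits at relative position \<open>f k\<close> in its dyadic interval, so at
    every level this mean is the one of a and b at \<nu>.\<close>
  have mean: "wgm (x k) (y k) (f k) = a powr (1 - \<nu>) * b powr \<nu>" for k
  proof -
    have "2 ^ k * \<nu> = m_seq \<nu> k + f k" by (simp add: m_seq_def f_def frac_def)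
    then have "\<nu> = (m_seq \<nu> k + f k) / 2 ^ k" by (simp add: field_simps)
    also have "\<dots> = (1 - f k) * (m_seq \<nu> k / 2 ^ k) + f k * ((m_seq \<nu> k + 1) / 2 ^ k)"
      by (simp add: add_divide_distrib diff_divide_distrib algebra_simps)
    finally have "(1 - f k) * (m_seq \<nu> k / 2 ^ k) + f k * ((m_seq \<nu> k + 1) / 2 ^ k) = \<nu>" ..
    then show ?thesis
      using assms unfolding x_def y_def by (simp add: wgm_wgm) (simp add: wgm_def)
  qed
  have middle: "(1 - \<nu>) * a + \<nu> * b - young_sum a b \<nu> k = (1 - f k) * x k + f k * y k" for k
    using assms by (simp add: arith_mean_minus_young_sum x_def y_def f_def)
  have f: "0 \<le> f k" "f k \<le> 1" "r_seq \<nu> k = min (f k) (1 - f k)" for k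
    using assms by (simp_all add: f_def r_seq_eq_frac frac_lt_1 less_imp_le)
  \<comment> \<open>With both exponents 1/2, only the arithmetic mean of \<open>x k\<close> and
    \<open>y k\<close> survives.\<close>
  have exact: "kantorovich2 (h powr (1 / 2 ^ k)) powr (1/2) * (a powr (1 - \<nu>) * b powr \<nu>)
      = (1 - f k) * x k + f k * y k" if "f k = 1/2" for k
    using kantorovich2_powr_mult_wgm[OF pos, of k k "1/2" "f k"] pos[of k]
    unfolding ratio mean unfolding that by (simp add: add_pos_pos)
  have "kantorovich2 (h powr (1 / 2 ^ (t - 1))) powr r_seq \<nu> (t - 1) * (a powr (1 - \<nu>) * b powr \<nu>)
        = (1 - f (t - 1)) * x (t - 1) + f (t - 1) * y (t - 1)
      \<and> (odd p \<longrightarrow> (1 - f (t - 1)) * x (t - 1) + f (t - 1) * y (t - 1)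
        = kantorovich2 (h powr (1 / 2 ^ (t - 1))) powr R_seq \<nu> (t - 1)
          * (a powr (1 - \<nu>) * b powr \<nu>))"
    if "t > 1" "\<nu> = real p / 2 ^ t" for p t :: nat
  proof -
    obtain k where k: "t = Suc k" using \<open>t > 1\<close> by (cases t) auto
    \<comment> \<open>Multiplying by 2^(t - 1) leaves one binary digit after the point, so the
      parity of p decides between \<open>f k\<close> = 0 and \<open>f k\<close> = 1/2.\<close>
    have "2 ^ k * \<nu> = real p / 2" using that k by simp
    then have fk: "f k = frac (real p / 2)" by (simp only: f_def)
    show ?thesis
    proof (cases "even p")
      case True
      \<comment> \<open>Here \<open>r_seq \<nu> k\<close> = 0 and both sides of the first equality
        are \<open>x k\<close>. As \<open>R_seq \<nu> k\<close> = 1, the second equality would force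
        the constant to be 1, hence its restriction to odd p.\<close>
      then have "f k = 0" unfolding fk by auto
      moreover have "h powr (1 / 2 ^ k) > 0" using assms by simp
      ultimately show ?thesis
        using True f(3)[of k] mean[of k] pos[of k] kantorovich2_pos[of "h powr (1 / 2 ^ k)"] k
        by (simp add: wgm_def)
    next
      case False
      then obtain q where "p = 2 * q + 1" by (auto elim: oddE)
      then have "real p / 2 - 1/2 = real q" by (simp add: field_simps)
      then have half: "f k = 1/2" unfolding fk frac_unique_iff by simp
      then have r: "r_seq \<nu> k = 1/2" "R_seq \<nu> k = 1/2"
        using f(3)[of k] by (simp_all add: R_seq_def)
      show ?thesis
        using exact[OF half] unfolding k diff_Suc_1 r by simp
    qed
  qed
  then show ?thesis
    using kantorovich2_young[of "x n" "y n" "f n", OF pos f] unfolding middle ratio mean R_seq_def by blast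
qed

end
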